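(* Let $\mathbb{X}$ be three points in generic position in $\mathbb{P}^1\times\mathbb{P}^1\times\mathbb{P}^1$. Then $\nu(I_{\mathbb{X}})>v(3;1,1,1)$.
   Context: $\mathbf{k}$ is an algebraically closed field of characteristic $0$; $\mathbb{N}=\{0,1,2,\ldots\}$; $e_1,e_2,e_3$ is the standard basis of $\mathbb{N}^3$; $\mathbb{N}^3$ is partially ordered coordinatewise, and $\min\mathcal{S}$ denotes the set of minimal elements of $\mathcal{S}\subseteq\mathbb{N}^3$. $R=\mathbf{k}[x_{l,m}: 1\le l\le 3,\ 0\le m\le 1]$ is $\mathbb{N}^3$-graded by $\deg x_{l,m}=e_l$; it is the coordinate ring of $\mathbb{P}^1\times\mathbb{P}^1\times\mathbb{P}^1$ over $\mathbf{k}$. $N(\underline{i})=\dim_{\mathbf{k}}R_{\underline{i}}=(i_1+1)(i_2+1)(i_3+1)$. For a nonempty finite set $\mathbb{X}$ of points, $I_{\mathbb{X}}\subseteq R$ is the ideal generated by the $\mathbb{N}^3$-homogeneous forms vanishing at every point of $\mathbb{X}$, and $\nu(I_{\mathbb{X}})$ is the minimal number of generators of $I_{\mathbb{X}}$. A set $\mathbb{X}$ of $s$ distinct points is in generic position if $\dim_{\mathbf{k}}(R/I_{\mathbb{X}})_{\underline{i}}=\min\{N(\underline{i}),s\}$ for all $\underline{i}\in\mathbb{N}^3$. Definition of $v(3;1,1,1)$: let $s=3$, $\mathcal{D}=\min\{\underline{i}\in\mathbb{N}^3\mid N(\underline{i})>s\}$ and $\mathcal{D}+e_l=\{\underline{i}+e_l\mid\underline{i}\in\mathcal{D}\}$;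 for $\underline{i}\in\mathcal{D}$ let $\mathbb{D}_{\underline{i}}=\{\underline{j}\in\mathbb{N}^3\mid\underline{j}\ge\underline{i}\}\setminus\{\underline{i},\underline{i}+e_1,\underline{i}+e_2,\underline{i}+e_3\}$; let $\mathbb{D}=\left[\bigcup_{l=1}^3(\mathcal{D}+e_l)\right]\setminus\bigcup_{\underline{i}\in\mathcal{D}}\mathbb{D}_{\underline{i}}$; for $\underline{j}\in\mathbb{D}$ let $L_{\underline{j}}=\{l\in\{1,2,3\}\mid\underline{j}\in\mathcal{D}+e_l\}$. Then $$v(3;1,1,1)=\sum_{\underline{i}\in\mathcal{D}}(N(\underline{i})-s)+\sum_{\underline{j}\in\mathbb{D}}\max\Big\{0,\ N(\underline{j})-s-\sum_{l\in L_{\underline{j}}}2\big(N(\underline{j}-e_l)-s\big)\Big\}.$$ *)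

theory Defs
  imports
    "HOL-Analysis.Analysis"
    "HOL-Library.Function_Algebras"
    "HOL-Library.Poly_Mapping"
    "HOL-Library.Extended_Nat"
begin

text \<open>
  The six variables are indexed by \<^typ>\<open>3 \<times> 2\<close>: the pair \<open>(l, m)\<close> is \<open>x\<^sub>l\<^sub>,\<^sub>m\<close>, where the
  elements of \<^typ>\<open>3\<close> are \<open>1, 2, 3 = 0\<close> and those of \<^typ>\<open>2\<close> are \<open>0, 1\<close>. Multidegrees in
  \<open>\<nat>\<^sup>3\<close> are functions \<^typ>\<open>3 \<Rightarrow> nat\<close>, with the pointwise order and arithmetic.
\<close>

type_synonym monomial = "(3 \<times> 2) \<Rightarrow>\<^sub>0 nat"
type_synonym 'k mpoly = "monomial \<Rightarrow>\<^sub>0 'k"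
type_synonym mdeg = "3 \<Rightarrow> nat"

definition unit_mdeg :: "3 \<Rightarrow> mdeg" where
  "unit_mdeg l = (\<lambda>k. if k = l then 1 else 0)"

definition monom_mdeg :: "monomial \<Rightarrow> mdeg" where
  "monom_mdeg a = (\<lambda>l. \<Sum>m\<in>UNIV. Poly_Mapping.lookup a (l, m))"

definition graded_piece :: "mdeg \<Rightarrow> ('k::field) mpoly set" where
  "graded_piece i = {F. \<forall>a\<in>Poly_Mapping.keys F. monom_mdeg a = i}"

definition scalar :: "'k::field \<Rightarrow> 'k mpoly \<Rightarrow> 'k mpoly" where
  "scalar c F = Poly_Mapping.single 0 c * F"

definition eval_form :: "(3 \<Rightarrow> 2 \<Rightarrow> 'k) \<Rightarrow> ('k::field) mpoly \<Rightarrow> 'k" where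
  "eval_form x F = (\<Sum>a\<in>Poly_Mapping.keys F.
     Poly_Mapping.lookup F a * (\<Prod>(l, m)\<in>UNIV. x l m ^ Poly_Mapping.lookup a (l, m)))"

definition ideal_gen :: "('k::field) mpoly set \<Rightarrow> 'k mpoly set" where
  "ideal_gen = module.span (*)"

definition num_gens :: "('k::field) mpoly set \<Rightarrow> enat" where
  "num_gens I = (INF G\<in>{G. finite G \<and> ideal_gen G = I}. enat (card G))"

definition P1 :: "(2 \<Rightarrow> 'k::field) set set" where
  "P1 = {v. v \<noteq> 0} //
     {(v, w). v \<noteq> 0 \<and> w \<noteq> 0 \<and> (\<exists>c. c \<noteq> 0 \<and> w = (\<lambda>m. c * v m))}"

definition P1xP1xP1 :: "(3 \<Rightarrow> (2 \<Rightarrow> 'k::field) set) set" where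
  "P1xP1xP1 = {P. \<forall>l. P l \<in> P1}"

definition vanishes_at :: "('k::field) mpoly \<Rightarrow> (3 \<Rightarrow> (2 \<Rightarrow> 'k) set) \<Rightarrow> bool" where
  "vanishes_at F P \<longleftrightarrow> (\<forall>x. (\<forall>l. x l \<in> P l) \<longrightarrow> eval_form x F = 0)"

definition vanishing_ideal :: "(3 \<Rightarrow> (2 \<Rightarrow> 'k::field) set) set \<Rightarrow> 'k mpoly set" where
  "vanishing_ideal X = ideal_gen {F. (\<exists>i. F \<in> graded_piece i) \<and> (\<forall>P\<in>X. vanishes_at F P)}"

text \<open>
  \<open>basis_mod I V B\<close>: the elements of \<open>B \<subseteq> V\<close> are representatives of a \<open>k\<close>-basis of the image of
  \<open>V\<close> in \<open>R/I\<close>. Independence makes the classes of distinct elements of \<open>B\<close> distinct, so \<open>card B\<close>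
  is the dimension of that image. For \<open>V = graded_piece i\<close> the image is \<open>(R/I)\<^sub>i\<close>.
\<close>

definition basis_mod :: "('k::field) mpoly set \<Rightarrow> 'k mpoly set \<Rightarrow> 'k mpoly set \<Rightarrow> bool" where
  "basis_mod I V B \<longleftrightarrow> B \<subseteq> V \<and>
     (\<forall>T c. finite T \<longrightarrow> T \<subseteq> B \<longrightarrow> (\<Sum>b\<in>T. scalar (c b) b) \<in> I \<longrightarrow> (\<forall>b\<in>T. c b = 0)) \<and>
     (\<forall>F\<in>V. \<exists>G\<in>module.span scalar B. F - G \<in> I)"

definition hilbert_fun :: "('k::field) mpoly set \<Rightarrow> mdeg \<Rightarrow> nat" where
  "hilbert_fun I i = card (SOME B. basis_mod I (graded_piece i) B)"

definition N :: "mdeg \<Rightarrow> nat" where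
  "N i = (\<Prod>l\<in>UNIV. i l + 1)"

definition generic_position :: "(3 \<Rightarrow> (2 \<Rightarrow> 'k::field) set) set \<Rightarrow> bool" where
  "generic_position X \<longleftrightarrow>
     (\<forall>i. hilbert_fun (vanishing_ideal X) i = min (N i) (card X))"

definition min_elems :: "mdeg set \<Rightarrow> mdeg set" where
  "min_elems S = {i\<in>S. \<forall>j\<in>S. j \<le> i \<longrightarrow> j = i}"

definition D_set :: "nat \<Rightarrow> mdeg set" where
  "D_set s = min_elems {i. N i > s}"

definition D_shift :: "nat \<Rightarrow> 3 \<Rightarrow> mdeg set" where
  "D_shift s l = (\<lambda>i. i + unit_mdeg l) ` D_set s"

definition DD_above :: "mdeg \<Rightarrow> mdeg set" where
  "DD_above i = {j. j \<ge> i} - ({i} \<union> range (\<lambda>l. i + unit_mdeg l))"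

definition DD_set :: "nat \<Rightarrow> mdeg set" where
  "DD_set s = (\<Union>l. D_shift s l) - (\<Union>i\<in>D_set s. DD_above i)"

definition L_set :: "nat \<Rightarrow> mdeg \<Rightarrow> 3 set" where
  "L_set s j = {l. j \<in> D_shift s l}"

text \<open>\<open>v111 s\<close> is \<open>v(s; 1, 1, 1)\<close>; both sums are over finite sets.\<close>

definition v111 :: "nat \<Rightarrow> int" where
  "v111 s = (\<Sum>i\<in>D_set s. int (N i) - int s) +
     (\<Sum>j\<in>DD_set s. max 0 (int (N j) - int s
        - (\<Sum>l\<in>L_set s j. 2 * (int (N (j - unit_mdeg l)) - int s))))"

lemma v111_nonneg: "v111 s \<ge> 0"
  unfolding v111_def
  by (intro add_nonneg_nonneg sum_nonneg) (auto simp: D_set_def min_elems_def)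

lemma module_mult: "module ((*) :: 'k::field mpoly \<Rightarrow> _)"
  by unfold_locales (simp_all add: algebra_simps)

lemma vector_space_scalar: "vector_space (scalar :: 'k::field \<Rightarrow> _)"
  by unfold_locales
    (simp_all add: scalar_def algebra_simps single_add mult_single flip: mult.assoc)

end

theory Submission
  imports Defs
begin

text \<open>
  Generic position makes the coordinates of the three points distinct in every factor: otherwise a
  product of two linear forms in \<open>x\<^sub>l\<^sub>,\<^sub>0, x\<^sub>l\<^sub>,\<^sub>1\<close> vanishes on the set, although
  the Hilbert function in degree \<open>2e\<^sub>l\<close> takes the full value \<open>N(2e\<^sub>l) = 3\<close>.
  So in every factor the points can be written \<open>u\<^sub>l\<close>, \<open>v\<^sub>l\<close>, \<open>u\<^sub>l + v\<^sub>l\<close>, and they lie on the rational curve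
  \<open>(s : t) \<mapsto> (s u\<^sub>l + t v\<^sub>l)\<^sub>l\<close>. A form of total degree at most 2 that vanishes at the three points
  vanishes on the whole curve, whereas in each of the ten degrees of total degree 3 some product of
  three linear forms vanishes at the three points and not at \<open>(u\<^sub>l - v\<^sub>l)\<^sub>l\<close>. Hence the ideal needs a
  generator in each of these ten degrees. It also needs the bilinear form of each degree
  \<open>e\<^sub>a + e\<^sub>b\<close>, which makes at least 13 generators, while \<open>v(3; 1, 1, 1) = 12\<close>: the numerical count
  misses that the three bilinear forms have a syzygy in degree \<open>(1, 1, 1)\<close>.
\<close>

section \<open>The value of \<open>v(3; 1, 1, 1)\<close>\<close>

definition mk :: "nat \<Rightarrow> nat \<Rightarrow> nat \<Rightarrow> mdeg" where
  "mk a b c = (\<lambda>l. if l = 1 then a else if l = 2 then b else c)"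

lemma mk_surj: "mk (i 1) (i 2) (i 3) = i"
  unfolding mk_def fun_eq_iff forall_3 by simp

lemma mk_cases: obtains a b c where "i = mk a b c"
  using that[OF mk_surj[symmetric]] .

lemma mk_le_iff [simp]: "mk a b c \<le> mk a' b' c' \<longleftrightarrow> a \<le> a' \<and> b \<le> b' \<and> c \<le> c'"
  unfolding mk_def le_fun_def forall_3 by simp

lemma mk_eq_iff [simp]: "mk a b c = mk a' b' c' \<longleftrightarrow> a = a' \<and> b = b' \<and> c = c'"
  unfolding mk_def fun_eq_iff forall_3 by simp

lemma unit_mdeg_mk: "unit_mdeg 1 = mk 1 0 0" "unit_mdeg 2 = mk 0 1 0" "unit_mdeg 3 = mk 0 0 1"
  unfolding mk_def unit_mdeg_def fun_eq_iff forall_3 by simp_all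

lemma mk_add [simp]: "mk a b c + mk a' b' c' = mk (a + a') (b + b') (c + c')"
  by (simp add: mk_def fun_eq_iff)

lemma mk_diff [simp]: "mk a b c - mk a' b' c' = mk (a - a') (b - b') (c - c')"
  by (simp add: mk_def fun_eq_iff)

lemma N_mk [simp]: "N (mk a b c) = (a + 1) * (b + 1) * (c + 1)"
  unfolding N_def UNIV_3 by (simp add: mk_def algebra_simps)

text \<open>If two coordinates are positive, \<open>i\<close> lies above a sum of two distinct unit
  vectors. Otherwise \<open>N i\<close> is one coordinate plus 1, so that coordinate is at least
  3.\<close>

lemma N_gt_3_above:
  assumes "N i > 3"
  shows "\<exists>j\<in>{mk 3 0 0, mk 0 3 0, mk 0 0 3, mk 1 1 0, mk 1 0 1, mk 0 1 1}. j \<le> i"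
proof -
  obtain a b c where i: "i = mk a b c" by (rule mk_cases)
  show ?thesis using assms unfolding i
    by (cases a; cases b; cases c) auto
qed

lemma D_set_3: "D_set 3 = {mk 3 0 0, mk 0 3 0, mk 0 0 3, mk 1 1 0, mk 1 0 1, mk 0 1 1}"
  (is "_ = ?D")
proof (intro equalityI subsetI)
  fix i assume "i \<in> D_set 3"
  then have i: "N i > 3" "\<And>j. N j > 3 \<Longrightarrow> j \<le> i \<Longrightarrow> j = i"
    unfolding D_set_def min_elems_def by blast+
  obtain j where j: "j \<in> ?D" "j \<le> i"
    using N_gt_3_above[OF i(1)] by blast
  have "N j > 3" using j(1) by auto
  then show "i \<in> ?D" using i(2) j by metis
next
  fix i assume i: "i \<in> ?D"
  have "j = i" if N: "N j > 3" and le: "j \<le> i" for j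
  proof -
    obtain k where k: "k \<in> ?D" "k \<le> j" using N_gt_3_above[OF N] by blast
    have "k \<le> i" using k(2) le by (rule order_trans)
    \<comment> \<open>The six listed degrees form an antichain, and \<open>k \<le> i\<close> are
      both among them.\<close>
    then have "k = i" using i k(1) by auto
    then show "j = i" using le k(2) by simp
  qed
  moreover have "N i > 3" using i by auto
  ultimately show "i \<in> D_set 3" unfolding D_set_def min_elems_def by blast
qed

lemma D_shift_3:
  "D_shift 3 1 = {mk 4 0 0, mk 1 3 0, mk 1 0 3, mk 2 1 0, mk 2 0 1, mk 1 1 1}"
  "D_shift 3 2 = {mk 3 1 0, mk 0 4 0, mk 0 1 3, mk 1 2 0, mk 1 1 1, mk 0 2 1}"
  "D_shift 3 3 = {mk 3 0 1, mk 0 3 1, mk 0 0 4, mk 1 1 1, mk 1 0 2, mk 0 1 2}"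
  unfolding D_shift_def D_set_3 unit_mdeg_mk by auto

text \<open>A degree above \<open>mk a b c\<close> whose coordinate sum exceeds by at most 1 is
  \<open>mk a b c\<close> itself or a translate by one unit vector, so only larger excesses
  remain.\<close>

lemma DD_above_mk:
  "mk a' b' c' \<in> DD_above (mk a b c) \<longleftrightarrow> a \<le> a' \<and> b \<le> b' \<and> c \<le> c' \<and> a' + b' + c' > a + b + c + 1"
  unfolding DD_above_def UNIV_3 by (auto simp: unit_mdeg_mk)

text \<open>Shifts such as \<open>mk 3 1 0\<close> drop out: they exceed a bilinear degree, here
  \<open>mk 1 1 0\<close>, by 2 in total.\<close>

lemma DD_set_3:
  "DD_set 3 = {mk 4 0 0, mk 0 4 0, mk 0 0 4, mk 2 1 0, mk 2 0 1, mk 1 2 0, mk 0 2 1, mk 1 0 2,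
     mk 0 1 2, mk 1 1 1}"
  unfolding DD_set_def UNIV_3 D_set_3
  by (auto simp: D_shift_3 DD_above_mk)

lemma L_set_3: "L_set 3 j = {l\<in>{1,2,3}. j \<in> D_shift 3 l}"
  by (simp add: L_set_def flip: UNIV_3)

lemma L_set_mk:
  "L_set 3 (mk 4 0 0) = {1}" "L_set 3 (mk 0 4 0) = {2}" "L_set 3 (mk 0 0 4) = {3}"
  "L_set 3 (mk 2 1 0) = {1}" "L_set 3 (mk 2 0 1) = {1}" "L_set 3 (mk 1 2 0) = {2}"
  "L_set 3 (mk 0 2 1) = {2}" "L_set 3 (mk 1 0 2) = {3}" "L_set 3 (mk 0 1 2) = {3}"
  "L_set 3 (mk 1 1 1) = {1,2,3}"
  unfolding L_set_3 Collect_conj_eq insert_Collect by (auto simp: D_shift_3)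

text \<open>Each of the six degrees in \<open>D_set 3\<close> contributes 1. In
  \<open>DD_set 3\<close> the permutations of \<open>mk 2 1 0\<close> give 3 - 2 = 1 each, those of
  \<open>mk 4 0 0\<close> give 2 - 2 = 0, and \<open>mk 1 1 1\<close> gives 5 - 6, truncated to
  0.\<close>

lemma v111_3: "v111 3 = 12"
  unfolding v111_def DD_set_3 D_set_3 by (simp add: L_set_mk unit_mdeg_mk del: One_nat_def)

section \<open>Linear functionals on polynomials\<close>

text \<open>The linear functional with prescribed values \<open>w\<close> on monomials. Evaluation
  of a form and of a single graded component are both instances.\<close>

definition lin_ext :: "('a \<Rightarrow> 'b) \<Rightarrow> ('a \<Rightarrow>\<^sub>0 'b::comm_ring_1) \<Rightarrow> 'b" where
  "lin_ext w F = (\<Sum>a\<in>Poly_Mapping.keys F. Poly_Mapping.lookup F a * w a)"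

lemma lin_ext_0 [simp]: "lin_ext w 0 = 0"
  by (simp add: lin_ext_def)

lemma lin_ext_add: "lin_ext w (F + G) = lin_ext w F + lin_ext w G"
  unfolding lin_ext_def by (rule setsum_keys_plus_distrib) (auto simp: algebra_simps)

lemma lin_ext_single [simp]: "lin_ext w (Poly_Mapping.single a c) = c * w a"
  by (simp add: lin_ext_def)

lemma lin_ext_sum: "lin_ext w (\<Sum>i\<in>A. F i) = (\<Sum>i\<in>A. lin_ext w (F i))"
  by (induction A rule: infinite_finite_induct) (auto simp: lin_ext_add)

lemma lin_ext_cong: "(\<And>a. a \<in> Poly_Mapping.keys F \<Longrightarrow> w a = w' a) \<Longrightarrow> lin_ext w F = lin_ext w' F"
  by (simp add: lin_ext_def)

lemma lin_ext_cmult: "lin_ext (\<lambda>a. c * w a) F = c * lin_ext w F"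
  unfolding lin_ext_def sum_distrib_left by (simp add: mult_ac)

lemma lin_ext_multc: "lin_ext (\<lambda>a. w a * c) F = lin_ext w F * c"
  unfolding lin_ext_def sum_distrib_right by (simp add: mult_ac)

lemma poly_mapping_sum_single:
  "F = (\<Sum>a\<in>Poly_Mapping.keys F. Poly_Mapping.single a (Poly_Mapping.lookup F a))"
  by (rule poly_mapping_eqI) (auto simp: lookup_sum lookup_single when_def in_keys_iff)

lemma lin_ext_mult:
  "lin_ext w (F * G) = lin_ext (\<lambda>a. lin_ext (\<lambda>b. w (a + b)) G) F"
proof -
  have "F * G = (\<Sum>a\<in>Poly_Mapping.keys F. \<Sum>b\<in>Poly_Mapping.keys G.
      Poly_Mapping.single (a + b) (Poly_Mapping.lookup F a * Poly_Mapping.lookup G b))"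
    by (subst poly_mapping_sum_single[of F], subst poly_mapping_sum_single[of G])
      (simp add: sum_product mult_single)
  then show ?thesis
    by (simp add: lin_ext_sum) (simp add: lin_ext_def sum_distrib_left mult.assoc)
qed

section \<open>Evaluation of monomials, forms and graded components\<close>

definition monom_val :: "(3 \<Rightarrow> 2 \<Rightarrow> 'k::field) \<Rightarrow> monomial \<Rightarrow> 'k" where
  "monom_val x a = (\<Prod>(l, m)\<in>UNIV. x l m ^ Poly_Mapping.lookup a (l, m))"

lemma monom_val_0 [simp]: "monom_val x 0 = 1"
  by (simp add: monom_val_def case_prod_unfold)

lemma monom_val_add: "monom_val x (a + b) = monom_val x a * monom_val x b"
  by (simp add: monom_val_def case_prod_unfold lookup_add power_add prod.distrib)

lemma monom_val_single [simp]: "monom_val x (Poly_Mapping.single (l, m) (Suc 0)) = x l m"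
proof -
  have "monom_val x (Poly_Mapping.single (l, m) (Suc 0)) = (\<Prod>p\<in>UNIV. if p = (l, m) then x l m else 1)"
    unfolding monom_val_def
    by (rule prod.cong) (auto simp: lookup_single when_def simp del: One_nat_def split: prod.splits if_splits)
  then show ?thesis by simp
qed

lemma eval_form_lin_ext: "eval_form x F = lin_ext (monom_val x) F"
  by (simp add: eval_form_def lin_ext_def monom_val_def)

lemma eval_form_mult: "eval_form x (F * G) = eval_form x F * eval_form x G"
  by (simp add: eval_form_lin_ext lin_ext_mult monom_val_add lin_ext_cmult lin_ext_multc)

text \<open>The value at \<open>x\<close> of the component of degree \<open>e\<close>. The
  generating sets in \<open>num_gens\<close> may contain inhomogeneous polynomials, so components of
  arbitrary polynomials have to be evaluated.\<close>

definition comp_eval :: "mdeg \<Rightarrow> (3 \<Rightarrow> 2 \<Rightarrow> 'k) \<Rightarrow> ('k::field) mpoly \<Rightarrow> 'k" where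
  "comp_eval e x = lin_ext (\<lambda>a. if monom_mdeg a = e then monom_val x a else 0)"

lemma monom_mdeg_0 [simp]: "monom_mdeg 0 = 0"
  by (simp add: monom_mdeg_def fun_eq_iff)

lemma monom_mdeg_add [simp]: "monom_mdeg (a + b) = monom_mdeg a + monom_mdeg b"
  by (simp add: monom_mdeg_def fun_eq_iff lookup_add sum.distrib)

lemma monom_mdeg_single [simp]: "monom_mdeg (Poly_Mapping.single (l, m) (Suc 0)) = unit_mdeg l"
  by (auto simp: monom_mdeg_def fun_eq_iff lookup_single when_def unit_mdeg_def)

lemma monom_mdeg_eq_0_iff [simp]: "monom_mdeg a = 0 \<longleftrightarrow> a = 0"
  by (auto simp: monom_mdeg_def fun_eq_iff poly_mapping_eq_iff)

lemma comp_eval_graded: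
  "F \<in> graded_piece d \<Longrightarrow> comp_eval e x F = (if e = d then eval_form x F else 0)"
  unfolding comp_eval_def eval_form_lin_ext
  by (auto simp: graded_piece_def lin_ext_def intro!: sum.cong)

lemma comp_eval_mult:
  "comp_eval e x (F * G) =
     lin_ext (\<lambda>a. if monom_mdeg a \<le> e then monom_val x a * comp_eval (e - monom_mdeg a) x G else 0) F"
proof -
  have "a + b = e \<longleftrightarrow> a \<le> e \<and> b = e - a" for a b :: mdeg
  proof -
    have "a i + b i = e i \<longleftrightarrow> a i \<le> e i \<and> b i = e i - a i" for i by auto
    then show ?thesis by (simp add: fun_eq_iff le_fun_def all_conj_distrib)
  qed
  then have *: "lin_ext (\<lambda>b. if monom_mdeg a + monom_mdeg b = e then monom_val x a * monom_val x b else 0) G =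
    (if monom_mdeg a \<le> e then monom_val x a * comp_eval (e - monom_mdeg a) x G else 0)" for a
    by (auto simp: comp_eval_def lin_ext_def sum_distrib_left intro!: sum.cong)
  have "comp_eval e x (F * G) = lin_ext (\<lambda>a. lin_ext (\<lambda>b.
      if monom_mdeg a + monom_mdeg b = e then monom_val x a * monom_val x b else 0) G) F"
    unfolding comp_eval_def lin_ext_mult monom_val_add monom_mdeg_add ..
  then show ?thesis unfolding * .
qed

lemma graded_piece_mult:
  assumes "F \<in> graded_piece d" "G \<in> graded_piece e"
  shows "F * G \<in> graded_piece (d + e)"
  using assms keys_mult[of F G] by (fastforce simp: graded_piece_def)

text \<open>The ideal is generated by forms vanishing at \<open>P\<close>, so every component of
  each of its elements vanishes there too.\<close>

lemma comp_eval_vanishing_ideal: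
  assumes "F \<in> vanishing_ideal X" "P \<in> X" "\<And>l. x l \<in> P l"
  shows "comp_eval e x F = 0"
  using assms(1) unfolding vanishing_ideal_def ideal_gen_def
proof (induction arbitrary: e rule: module.span_induct_alt[OF module_mult, consumes 1, case_names base step])
  case (step r g G)
  then obtain d where d: "g \<in> graded_piece d" "vanishes_at g P" using assms by blast
  then have "comp_eval e x g = 0" for e
    using assms(3) by (simp add: comp_eval_graded vanishes_at_def)
  then have "comp_eval e x (r * g) = 0" for e
    unfolding comp_eval_mult lin_ext_def by (intro sum.neutral) simp
  then show ?case using step by (simp add: comp_eval_def lin_ext_add)
qed (simp add: comp_eval_def)

text \<open>A nonconstant monomial of \<open>F\<close> meets only components of \<open>G\<close>
  below \<open>d\<close>, which vanish at \<open>x\<close>. Only the constant term of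
  \<open>F\<close> survives.\<close>

lemma comp_eval_mult_leading:
  assumes "\<And>e. e < d \<Longrightarrow> comp_eval e x G = 0"
  shows "comp_eval d x (F * G) = Poly_Mapping.lookup F 0 * comp_eval d x G"
proof -
  have "d - c < d" if le: "c \<le> d" and ne: "c \<noteq> 0" for c :: mdeg
  proof -
    \<comment> \<open>Truncated subtraction strictly lowers coordinate \<open>l\<close>, since
      \<open>0 < c l \<le> d l\<close>.\<close>
    obtain l where "c l \<noteq> 0" using ne by (auto simp: fun_eq_iff)
    moreover have "c l \<le> d l" using le by (simp add: le_fun_def)
    ultimately have "\<not> d \<le> d - c" by (auto simp: le_fun_def intro!: exI[of _ l])
    then show ?thesis by (simp add: less_le_not_le) (simp add: le_fun_def)
  qed
  then have "comp_eval d x (F * G) = lin_ext (\<lambda>a. if a = 0 then comp_eval d x G else 0) F"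
    unfolding comp_eval_mult using assms by (auto intro!: lin_ext_cong)
  also have "\<dots> = Poly_Mapping.lookup F 0 * comp_eval d x G"
    by (auto simp: lin_ext_def if_distrib in_keys_iff cong: if_cong)
  finally show ?thesis .
qed

section \<open>Counting generators\<close>

lemma vector_space_fun: "vector_space (\<lambda>(c::'k::field) (f::'a \<Rightarrow> 'k) i. c * f i)"
  by unfold_locales (auto simp: fun_eq_iff algebra_simps)

text \<open>By \<open>mult\<close> the functionals kill \<open>m I\<close>, where \<open>m\<close>
  is the ideal of polynomials without constant term, so they factor through \<open>I / m I\<close>,
  which \<open>G\<close> spans over the field. The family \<open>f\<close> is dual to them up to
  nonzero factors and so stays independent in that quotient.\<close>

lemma card_le_generators:
  fixes G :: "'k::field mpoly set" and \<phi> :: "'i \<Rightarrow> 'k mpoly \<Rightarrow> 'k"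
  assumes G: "finite G" "ideal_gen G = I"
    and add: "\<And>i F H. i \<in> J \<Longrightarrow> \<phi> i (F + H) = \<phi> i F + \<phi> i H"
    and mult: "\<And>i F H. i \<in> J \<Longrightarrow> H \<in> I \<Longrightarrow> \<phi> i (F * H) = Poly_Mapping.lookup F 0 * \<phi> i H"
    and f: "\<And>i. i \<in> J \<Longrightarrow> f i \<in> I"
    and diag: "\<And>i. i \<in> J \<Longrightarrow> \<phi> i (f i) \<noteq> 0"
    and off_diag: "\<And>i j. i \<in> J \<Longrightarrow> j \<in> J \<Longrightarrow> i \<noteq> j \<Longrightarrow> \<phi> i (f j) = 0"
  shows "card J \<le> card G"
proof -
  interpret fs: vector_space "\<lambda>(c::'k) (f::'i \<Rightarrow> 'k) i. c * f i" by (rule vector_space_fun)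
  define v where "v H = (\<lambda>i. if i \<in> J then \<phi> i H else 0)" for H
  have GI: "G \<subseteq> I" using G(2) module.span_superset[OF module_mult] by (auto simp: ideal_gen_def)
  have zero: "0 \<in> I" using G(2) module.span_zero[OF module_mult] by (auto simp: ideal_gen_def)
  have v0: "v 0 = 0" using mult[OF _ zero, of _ 0] by (auto simp: v_def fun_eq_iff)
  have v_span: "v H \<in> fs.span (v ` G)" if "H \<in> I" for H
    using that[folded G(2)] unfolding ideal_gen_def
  proof (induction rule: module.span_induct_alt[OF module_mult, consumes 1, case_names base step])
    case base
    then show ?case unfolding v0 by (rule fs.span_zero)
  next
    case (step r g H)
    have "v (r * g + H) = (\<lambda>i. Poly_Mapping.lookup r 0 * v g i) + v H"
      using step(1) GI by (auto simp: v_def fun_eq_iff add mult)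
    moreover have "(\<lambda>i. Poly_Mapping.lookup r 0 * v g i) \<in> fs.span (v ` G)"
      using step(1) by (intro fs.span_scale fs.span_base) auto
    ultimately show ?case using step(2) fs.span_add by metis
  qed
  have vf: "v (f j) i = (if i = j then \<phi> j (f j) else 0)" if "j \<in> J" for i j
    using that off_diag by (auto simp: v_def)
  have ne: "v (f j) j \<noteq> 0" if "j \<in> J" for j using vf[OF that] diag that by simp
  have inj: "inj_on (\<lambda>j. v (f j)) J"
    by (rule inj_onI) (metis ne vf)
  have "fs.independent ((\<lambda>j. v (f j)) ` J)"
    unfolding fs.dependent_def
  proof safe
    fix j assume j: "j \<in> J" and "v (f j) \<in> fs.span ((\<lambda>j. v (f j)) ` J - {v (f j)})"
    \<comment> \<open>Coordinate \<open>j\<close> is zero on each remaining vector, hence on their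
      span.\<close>
    moreover have "h j = 0" if "h \<in> fs.span ((\<lambda>j. v (f j)) ` J - {v (f j)})" for h
      using that
    proof (induction rule: fs.span_induct_alt)
      case (step c x y)
      then obtain i where "i \<in> J" "x = v (f i)" "i \<noteq> j" by auto
      then show ?case using step vf[of i j] by simp
    qed simp
    ultimately show False using ne by blast
  qed
  then have "card ((\<lambda>j. v (f j)) ` J) \<le> card (v ` G)"
    using fs.independent_span_bound[of "v ` G"] v_span f G(1) by auto
  also have "\<dots> \<le> card G" using G(1) by (rule card_image_le)
  finally show ?thesis by (simp add: card_image[OF inj])
qed

section \<open>Linear forms and points of the projective line\<close>

definition det2 :: "(2 \<Rightarrow> 'k::field) \<Rightarrow> (2 \<Rightarrow> 'k) \<Rightarrow> 'k" where
  "det2 v w = v 1 * w 2 - v 2 * w 1"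

text \<open>For nonzero \<open>v\<close>, the linear form in the variables of factor
  \<open>l\<close> whose only zero on the projective line is the class of \<open>v\<close>.\<close>

definition lin_form :: "3 \<Rightarrow> (2 \<Rightarrow> 'k::field) \<Rightarrow> 'k mpoly" where
  "lin_form l v = Poly_Mapping.single (Poly_Mapping.single (l, 1) 1) (v 2)
     + Poly_Mapping.single (Poly_Mapping.single (l, 2) 1) (- v 1)"

lemma eval_form_add: "eval_form x (F + G) = eval_form x F + eval_form x G"
  by (simp add: eval_form_lin_ext lin_ext_add)

lemma eval_lin_form [simp]: "eval_form x (lin_form l v) = det2 (x l) v"
  by (simp add: lin_form_def eval_form_lin_ext lin_ext_add det2_def algebra_simps)

lemma graded_piece_add:
  assumes "F \<in> graded_piece d" "G \<in> graded_piece d"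
  shows "F + G \<in> graded_piece d"
  using assms keys_add[of F G] by (fastforce simp: graded_piece_def)

lemma lin_form_graded: "lin_form l v \<in> graded_piece (unit_mdeg l)"
  unfolding lin_form_def by (intro graded_piece_add) (auto simp: graded_piece_def)

section \<open>Classes in the projective line and their representatives\<close>

lemma P1_cases:
  assumes "A \<in> P1"
  obtains a where "a \<noteq> 0" "A = {w. w \<noteq> 0 \<and> (\<exists>c. c \<noteq> 0 \<and> w = (\<lambda>m. c * a m))}"
  using assms unfolding P1_def quotient_def by auto

lemma P1_nonempty:
  assumes "A \<in> P1"
  shows "\<exists>a. a \<in> A"
proof -
  obtain a where a: "a \<noteq> 0" "A = {w. w \<noteq> 0 \<and> (\<exists>c. c \<noteq> 0 \<and> w = (\<lambda>m. c * a m))}"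
    using assms by (rule P1_cases)
  have "\<exists>c. c \<noteq> 0 \<and> a = (\<lambda>m. c * a m)" by (rule exI[of _ 1]) simp
  then show ?thesis using a by blast
qed

lemma P1_eq:
  fixes A :: "(2 \<Rightarrow> 'k::field) set"
  assumes "A \<in> P1" "a \<in> A"
  shows "A = {(\<lambda>m. c * a m) | c. c \<noteq> 0}" and "a \<noteq> 0"
proof -
  obtain a0 where a0: "a0 \<noteq> 0" "A = {w. w \<noteq> 0 \<and> (\<exists>c. c \<noteq> 0 \<and> w = (\<lambda>m. c * a0 m))}"
    using assms(1) by (rule P1_cases)
  then obtain k where k: "k \<noteq> 0" "a = (\<lambda>m. k * a0 m)" and a: "a \<noteq> 0"
    using assms(2) by auto
  show "a \<noteq> 0" by fact
  show "A = {(\<lambda>m. c * a m) | c. c \<noteq> 0}"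
  proof safe
    fix x assume "x \<in> A"
    then obtain c where "c \<noteq> 0" "x = (\<lambda>m. c * a0 m)" using a0 by auto
    then show "\<exists>c. x = (\<lambda>m. c * a m) \<and> c \<noteq> 0"
      using k by (intro exI[of _ "c / k"]) auto
  next
    fix c :: 'k assume c: "c \<noteq> 0"
    then have "(\<lambda>m. c * a m) \<noteq> 0" using a by (auto simp: fun_eq_iff)
    moreover have "(\<lambda>m. c * a m) = (\<lambda>m. (c * k) * a0 m)" by (simp add: k(2) mult.assoc)
    moreover have "c * k \<noteq> 0" using c k(1) by simp
    ultimately show "(\<lambda>m. c * a m) \<in> A" unfolding a0(2) by blast
  qed
qed

lemma P1_scale: "A \<in> P1 \<Longrightarrow> a \<in> A \<Longrightarrow> c \<noteq> 0 \<Longrightarrow> (\<lambda>m. c * a m) \<in> A"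
  using P1_eq(1) by blast

lemma det2_same_class: "A \<in> P1 \<Longrightarrow> a \<in> A \<Longrightarrow> x \<in> A \<Longrightarrow> det2 x a = 0"
  using P1_eq(1)[of A a] by (auto simp: det2_def)

lemma fun2_eq_iff: "(f :: 2 \<Rightarrow> 'a) = g \<longleftrightarrow> f 1 = g 1 \<and> f 2 = g 2"
  by (simp add: fun_eq_iff forall_2)

lemma P1_eq_if_det2:
  assumes "A \<in> P1" "B \<in> P1" "a \<in> A" "b \<in> B" "det2 a b = 0"
  shows "A = B"
proof -
  have nz: "a \<noteq> 0" "b \<noteq> 0" using P1_eq(2) assms by auto
  obtain c where b: "b = (\<lambda>m. c * a m)"
  proof (cases "a 1 = 0")
    case True
    then have "a 2 \<noteq> 0" using nz by (simp add: fun2_eq_iff)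
    then have "b = (\<lambda>m. b 2 / a 2 * a m)" using True assms(5) by (auto simp: fun2_eq_iff det2_def)
    then show ?thesis by (rule that)
  next
    case False
    then have "b = (\<lambda>m. b 1 / a 1 * a m)"
      using assms(5) by (auto simp: fun2_eq_iff det2_def field_simps)
    then show ?thesis by (rule that)
  qed
  then have "c \<noteq> 0" using nz by (auto simp: fun_eq_iff)
  then have "b \<in> A" using P1_eq(1)[OF assms(1,3)] b by auto
  then show ?thesis using P1_eq(1)[OF assms(1)] P1_eq(1)[OF assms(2,4)] by simp
qed

lemma det2_scale: "det2 (\<lambda>m. s * a m) (\<lambda>m. t * b m) = s * t * det2 a b"
  by (simp add: det2_def algebra_simps)

text \<open>Cramer's rule: \<open>det2 a b\<close> times \<open>c\<close> equals
  \<open>det2 c b\<close> times \<open>a\<close> plus \<open>det2 a c\<close> times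
  \<open>b\<close>. Distinctness makes all three determinants nonzero, so \<open>a\<close> and
  \<open>b\<close> can be rescaled to have sum \<open>c\<close>.\<close>

lemma P1_frame:
  assumes "A \<in> P1" "B \<in> P1" "C \<in> P1" "A \<noteq> B" "A \<noteq> C" "B \<noteq> C"
  shows "\<exists>u v. u \<in> A \<and> v \<in> B \<and> u + v \<in> C \<and> det2 u v \<noteq> 0"
proof -
  obtain a b c where abc: "a \<in> A" "b \<in> B" "c \<in> C"
    using assms(1-3)[THEN P1_nonempty] by blast
  have d: "det2 a b \<noteq> 0" "det2 a c \<noteq> 0" "det2 c b \<noteq> 0"
    using P1_eq_if_det2[OF assms(1,2) abc(1,2)] P1_eq_if_det2[OF assms(1,3) abc(1,3)]
      P1_eq_if_det2[OF assms(3,2) abc(3,2)] assms(4-6) by blast+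
  define u where "u = (\<lambda>m. det2 c b / det2 a b * a m)"
  define v where "v = (\<lambda>m. det2 a c / det2 a b * b m)"
  have "u \<in> A" using d unfolding u_def by (intro P1_scale assms abc) auto
  moreover have "v \<in> B" using d unfolding v_def by (intro P1_scale assms abc) auto
  moreover have "u + v = c"
  proof -
    have "det2 c b * a m + det2 a c * b m = det2 a b * c m" if "m = 1 \<or> m = 2" for m
      using that by (auto simp: det2_def algebra_simps)
    then have "det2 a b * (u + v) m = det2 a b * c m" if "m = 1 \<or> m = 2" for m
      using that d by (simp add: u_def v_def field_simps)
    then show ?thesis using d by (simp add: fun2_eq_iff)
  qed
  moreover have "det2 u v = det2 c b / det2 a b * (det2 a c / det2 a b) * det2 a b"
    unfolding u_def v_def by (rule det2_scale)
  ultimately show ?thesis using d abc by (intro exI[of _ u] exI[of _ v]) simp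
qed

section \<open>Consequences of generic position\<close>

lemma ideal_gen_closed:
  assumes "F \<in> ideal_gen S" "G \<in> ideal_gen S"
  shows "F + G \<in> ideal_gen S" and "H * F \<in> ideal_gen S"
  using assms module.span_add[OF module_mult] module.span_scale[OF module_mult]
  by (auto simp: ideal_gen_def)

lemma zero_in_ideal_gen: "0 \<in> ideal_gen S"
  using module.span_zero[OF module_mult] by (auto simp: ideal_gen_def)

section \<open>Bases modulo an ideal and a strict bound on the Hilbert function\<close>

interpretation scalar: vector_space "scalar :: 'k::field \<Rightarrow> 'k mpoly \<Rightarrow> 'k mpoly"
  by (rule vector_space_scalar)

lemma subspace_ideal_gen: "scalar.subspace (ideal_gen S)"
  by (intro scalar.subspaceI) (auto simp: scalar_def ideal_gen_closed zero_in_ideal_gen)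

lemma graded_piece_scalar: "F \<in> graded_piece d \<Longrightarrow> scalar c F \<in> graded_piece d"
  using graded_piece_mult[of "Poly_Mapping.single 0 c" 0 F d]
  by (auto simp: scalar_def graded_piece_def)

lemma subspace_graded_piece: "scalar.subspace (graded_piece d)"
  by (intro scalar.subspaceI graded_piece_add graded_piece_scalar) (auto simp: graded_piece_def)

text \<open>Since \<open>hilbert_fun\<close> chooses a basis by \<open>SOME\<close>, existence must
  be shown before anything is known about its value. A basis \<open>B0\<close> of
  \<open>I \<inter> V\<close> is extended to a basis \<open>B1\<close> of \<open>V\<close>, and
  \<open>B1 - B0\<close> is taken.\<close>

lemma basis_mod_exists:
  assumes I: "scalar.subspace I" and V: "scalar.subspace V"
  shows "\<exists>B. basis_mod I V B"
proof -
  obtain B0 where B0: "B0 \<subseteq> I \<inter> V" "scalar.independent B0" "I \<inter> V \<subseteq> scalar.span B0"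
    by (rule scalar.maximal_independent_subset_extend[of "{}" "I \<inter> V", OF _ scalar.independent_empty]) simp
  obtain B1 where B1: "B0 \<subseteq> B1" "B1 \<subseteq> V" "scalar.independent B1" "V \<subseteq> scalar.span B1"
    using B0 by (auto intro: scalar.maximal_independent_subset_extend[of B0 V])
  have "c b = 0" if T: "finite T" "T \<subseteq> B1 - B0" "(\<Sum>b\<in>T. scalar (c b) b) \<in> I" "b \<in> T" for T c b
  proof (rule ccontr)
    assume nz: "c b \<noteq> 0"
    let ?S = "B1 - {b}"
    have "(\<Sum>b\<in>T. scalar (c b) b) \<in> V"
      using T B1 by (intro scalar.subspace_sum V scalar.subspace_scale) auto
    then have "(\<Sum>b\<in>T. scalar (c b) b) \<in> scalar.span B0" using T B0 by auto
    moreover have "scalar.span B0 \<subseteq> scalar.span ?S" using T B1 by (intro scalar.span_mono) auto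
    moreover have "(\<Sum>b\<in>T - {b}. scalar (c b) b) \<in> scalar.span ?S"
      using T by (intro scalar.span_sum scalar.span_scale scalar.span_base) auto
    ultimately have "(\<Sum>b\<in>T. scalar (c b) b) - (\<Sum>b\<in>T - {b}. scalar (c b) b) \<in> scalar.span ?S"
      by (intro scalar.span_diff) auto
    then have "scalar (c b) b \<in> scalar.span ?S" using T by (simp add: sum.remove)
    then have "scalar (inverse (c b)) (scalar (c b) b) \<in> scalar.span ?S" by (rule scalar.span_scale)
    then have "b \<in> scalar.span ?S" using nz by simp
    then show False using B1 T unfolding scalar.dependent_def by auto
  qed
  moreover have "\<exists>G\<in>scalar.span (B1 - B0). F - G \<in> I" if "F \<in> V" for F
  proof -
    have "F \<in> scalar.span (B0 \<union> (B1 - B0))" using that B1 by (auto simp: Un_absorb1)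
    then obtain x y where xy: "F = x + y" "x \<in> scalar.span B0" "y \<in> scalar.span (B1 - B0)"
      unfolding scalar.span_Un by auto
    then have "x \<in> I" using scalar.span_minimal[of B0 I] B0 I by auto
    then show ?thesis using xy by (intro bexI[of _ y]) auto
  qed
  ultimately show ?thesis using B1 by (intro exI[of _ "B1 - B0"]) (auto simp: basis_mod_def)
qed

text \<open>No nonzero element of \<open>I\<close> lies in the span of \<open>B\<close>, so
  \<open>insert F B\<close> is still independent in a space spanned by the monomials of degree
  \<open>d\<close>.\<close>

lemma card_basis_mod_less:
  fixes I :: "'k::field mpoly set"
  assumes I0: "0 \<in> I" and B: "basis_mod I (graded_piece d) B"
    and F: "F \<in> I" "F \<in> graded_piece d" "F \<noteq> 0"
    and fin: "finite {a. monom_mdeg a = d}"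
  shows "card B < card {a. monom_mdeg a = d}"
proof -
  let ?W = "(\<lambda>a. Poly_Mapping.single a (1::'k)) ` {a. monom_mdeg a = d}"
  have W: "graded_piece d \<subseteq> scalar.span ?W"
  proof
    fix G :: "'k mpoly" assume G: "G \<in> graded_piece d"
    have "G = (\<Sum>a\<in>Poly_Mapping.keys G. scalar (Poly_Mapping.lookup G a) (Poly_Mapping.single a 1))"
      by (subst poly_mapping_sum_single) (simp add: scalar_def mult_single)
    also have "\<dots> \<in> scalar.span ?W"
      using G by (intro scalar.span_sum scalar.span_scale scalar.span_base) (auto simp: graded_piece_def)
    finally show "G \<in> scalar.span ?W" .
  qed
  have ind: "\<And>T c. finite T \<Longrightarrow> T \<subseteq> B \<Longrightarrow> (\<Sum>b\<in>T. scalar (c b) b) \<in> I \<Longrightarrow> \<forall>b\<in>T. c b = 0"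
    and BV: "B \<subseteq> graded_piece d"
    using B unfolding basis_mod_def by blast+
  have "F \<notin> scalar.span B"
  proof
    assume "F \<in> scalar.span B"
    then obtain T r where T: "finite T" "T \<subseteq> B" "F = (\<Sum>a\<in>T. scalar (r a) a)"
      unfolding scalar.span_explicit by auto
    then have "\<forall>b\<in>T. r b = 0" using ind F by blast
    then show False using T F(3) by simp
  qed
  moreover have "scalar.independent B"
  proof
    assume "scalar.dependent B"
    then obtain T r b where T: "finite T" "T \<subseteq> B" "(\<Sum>a\<in>T. scalar (r a) a) = 0" "b \<in> T" "r b \<noteq> 0"
      unfolding scalar.dependent_explicit by blast
    then have "(\<Sum>a\<in>T. scalar (r a) a) \<in> I" using I0 by simp
    then show False using ind T by blast
  qed
  ultimately have "scalar.independent (insert F B)" and "F \<notin> B"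
    using scalar.independent_insertI scalar.span_base by auto
  moreover have "insert F B \<subseteq> scalar.span ?W" using W F BV by auto
  ultimately have "finite (insert F B)" "card (insert F B) \<le> card ?W"
    using scalar.independent_span_bound[of ?W "insert F B"] fin by auto
  moreover have "card ?W \<le> card {a. monom_mdeg a = d}" by (rule card_image_le[OF fin])
  ultimately show ?thesis using \<open>F \<notin> B\<close> by simp
qed

lemma hilbert_fun_less:
  assumes "F \<in> ideal_gen S" "F \<in> graded_piece d" "F \<noteq> 0" "finite {a. monom_mdeg a = d}"
  shows "hilbert_fun (ideal_gen S) d < card {a. monom_mdeg a = d}"
proof -
  have "basis_mod (ideal_gen S) (graded_piece d) (SOME B. basis_mod (ideal_gen S) (graded_piece d) B)"
    by (rule someI_ex[OF basis_mod_exists[OF subspace_ideal_gen subspace_graded_piece]])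
  from card_basis_mod_less[OF zero_in_ideal_gen this assms] show ?thesis
    unfolding hilbert_fun_def .
qed

text \<open>Such a monomial involves only the two variables of factor \<open>l\<close>, and the
  exponent of one of them, a number up to 2, determines it.\<close>

lemma finite_monomials_2:
  "finite {a. monom_mdeg a = unit_mdeg l + unit_mdeg l}" (is "finite ?A")
  and card_monomials_2: "card {a. monom_mdeg a = unit_mdeg l + unit_mdeg l} \<le> 3"
proof -
  have sum2: "Poly_Mapping.lookup a (k, 1) + Poly_Mapping.lookup a (k, 2) = (if k = l then 2 else 0)"
    if "a \<in> ?A" for a k
  proof -
    have "monom_mdeg a k = (unit_mdeg l + unit_mdeg l) k" using that by simp
    then show ?thesis by (simp add: monom_mdeg_def sum_2 unit_mdeg_def)
  qed
  have "inj_on (\<lambda>a. Poly_Mapping.lookup a (l, 1)) ?A"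
  proof (rule inj_onI)
    fix a b assume ab: "a \<in> ?A" "b \<in> ?A" "Poly_Mapping.lookup a (l, 1) = Poly_Mapping.lookup b (l, 1)"
    have "Poly_Mapping.lookup a (k, m) = Poly_Mapping.lookup b (k, m)" for k m
      using exhaust_2[of m] sum2[OF ab(1), of k] sum2[OF ab(2), of k] ab(3)
      by (auto split: if_splits)
    then show "a = b" by (intro poly_mapping_eqI) auto
  qed
  moreover have "(\<lambda>a. Poly_Mapping.lookup a (l, 1)) ` ?A \<subseteq> {..2::nat}"
    using sum2[of _ l] by fastforce
  ultimately show "finite ?A" "card ?A \<le> 3"
    using inj_on_finite[of _ ?A "{..2::nat}"] card_inj_on_le[of _ ?A "{..2::nat}"] by auto
qed

section \<open>Distinctness of the coordinates in every factor\<close>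

lemma vanishing_idealI:
  "F \<in> graded_piece d \<Longrightarrow> (\<And>P. P \<in> X \<Longrightarrow> vanishes_at F P) \<Longrightarrow> F \<in> vanishing_ideal X"
  unfolding vanishing_ideal_def ideal_gen_def
  by (rule module.span_base[OF module_mult]) auto

text \<open>Take \<open>y\<close> off the zero of the first form and \<open>z\<close> off that of
  the second. If neither avoids both zeros, \<open>y + z\<close> does.\<close>

lemma det2_avoid_two:
  assumes "a \<noteq> 0" "b \<noteq> 0"
  shows "\<exists>y. det2 y a \<noteq> 0 \<and> det2 y b \<noteq> 0"
proof -
  have *: "\<exists>y. det2 y c \<noteq> 0" if "c \<noteq> 0" for c :: "2 \<Rightarrow> 'a"
  proof (cases "c 1 = 0")
    case True
    then show ?thesis using that by (intro exI[of _ "\<lambda>m. if m = 1 then 1 else 0"]) (auto simp: det2_def fun2_eq_iff)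
  next
    case False
    then show ?thesis by (intro exI[of _ "\<lambda>m. if m = 2 then 1 else 0"]) (auto simp: det2_def)
  qed
  obtain y z where yz: "det2 y a \<noteq> 0" "det2 z b \<noteq> 0" using *[OF assms(1)] *[OF assms(2)] by blast
  have "det2 (y + z) c = det2 y c + det2 z c" for c
    by (simp add: det2_def algebra_simps)
  then have "det2 (y + z) a \<noteq> 0 \<and> det2 (y + z) b \<noteq> 0" if "det2 y b = 0" "det2 z a = 0"
    using that yz by simp
  then show ?thesis using yz by blast
qed

lemma generic_position_coordinates_distinct:
  fixes X :: "(3 \<Rightarrow> (2 \<Rightarrow> 'k::field) set) set"
  assumes X: "X \<subseteq> P1xP1xP1" "card X = 3" "generic_position X"
    and PQ: "P \<in> X" "Q \<in> X" "P \<noteq> Q"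
  shows "P l \<noteq> Q l"
proof
  assume eq: "P l = Q l"
  have "card (X - {P, Q}) = 1" using X PQ by (subst card_Diff_subset) auto
  then obtain R where "X - {P, Q} = {R}" by (rule card_1_singletonE)
  then have X_eq: "X = {P, Q, R}" using PQ by auto
  then have P1: "P l \<in> P1" "R l \<in> P1" using X by (auto simp: P1xP1xP1_def)
  obtain a b where ab: "a \<in> P l" "b \<in> R l" using P1[THEN P1_nonempty] by blast
  \<comment> \<open>The first factor vanishes at both \<open>P\<close> and \<open>Q\<close>, the
    second at the remaining point \<open>R\<close>.\<close>
  define F where "F = lin_form l a * lin_form l b"
  let ?d = "unit_mdeg l + unit_mdeg l"
  have F: "F \<in> graded_piece ?d" unfolding F_def by (intro graded_piece_mult lin_form_graded)
  have eval: "eval_form x F = det2 (x l) a * det2 (x l) b" for x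
    by (simp add: F_def eval_form_mult)
  have "F \<in> vanishing_ideal X"
  proof (rule vanishing_idealI[OF F])
    fix S assume "S \<in> X"
    then have "S l = P l \<or> S l = R l" using X_eq eq by auto
    then have "det2 y a * det2 y b = 0" if "y \<in> S l" for y
      using that det2_same_class[OF P1(1) ab(1)] det2_same_class[OF P1(2) ab(2)] by auto
    then show "vanishes_at F S" by (simp add: vanishes_at_def eval)
  qed
  moreover have "F \<noteq> 0"
  proof -
    obtain y where "det2 y a \<noteq> 0" "det2 y b \<noteq> 0"
      using det2_avoid_two[OF P1_eq(2)[OF P1(1) ab(1)] P1_eq(2)[OF P1(2) ab(2)]] by blast
    then have "eval_form (\<lambda>_. y) F \<noteq> 0" by (simp add: eval)
    then show ?thesis by (auto simp: eval_form_lin_ext)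
  qed
  ultimately have "hilbert_fun (vanishing_ideal X) ?d < 3"
    using hilbert_fun_less[OF _ F _ finite_monomials_2] card_monomials_2[of l]
    unfolding vanishing_ideal_def by fastforce
  moreover have "hilbert_fun (vanishing_ideal X) ?d = min (N ?d) 3"
    using X by (simp add: generic_position_def)
  moreover have "N ?d = 3" using exhaust_3[of l] by (auto simp: unit_mdeg_mk)
  ultimately show False by simp
qed

section \<open>Three points in general position\<close>

definition tot :: "mdeg \<Rightarrow> nat" where
  "tot e = (\<Sum>l\<in>UNIV. e l)"

lemma tot_add [simp]: "tot (d + e) = tot d + tot e"
  by (simp add: tot_def sum.distrib)

lemma tot_unit [simp]: "tot (unit_mdeg l) = 1"
  by (simp add: tot_def unit_mdeg_def)

lemma tot_eq_0_iff [simp]: "tot e = 0 \<longleftrightarrow> e = 0"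
  by (auto simp: tot_def fun_eq_iff)

lemma tot_strict_mono:
  assumes "e < d"
  shows "tot e < tot d"
proof -
  have "e \<le> d" "\<not> d \<le> e" using assms by (simp_all add: less_le_not_le)
  then have "\<forall>l. e l \<le> d l" "\<exists>l. e l < d l" by (auto simp: le_fun_def not_le)
  then show ?thesis
    unfolding tot_def by (intro sum_strict_mono_ex1) auto
qed

lemma mdeg_split:
  assumes "tot d = Suc n"
  obtains l e where "d = unit_mdeg l + e" "tot e = n"
proof -
  have "d \<noteq> 0" using assms by (metis tot_eq_0_iff nat.distinct(1))
  then obtain l where l: "d l \<noteq> 0" by (auto simp: fun_eq_iff)
  define e where "e = d - unit_mdeg l"
  have "d = unit_mdeg l + e" using l by (auto simp: e_def fun_eq_iff unit_mdeg_def)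
  moreover from this have "tot e = n" using assms by (metis tot_add tot_unit plus_1_eq_Suc nat.inject)
  ultimately show ?thesis by (rule that)
qed

lemma monomial_split:
  assumes "tot (monom_mdeg a) = Suc n"
  obtains l m b where "a = Poly_Mapping.single (l, m) 1 + b" "tot (monom_mdeg b) = n"
proof -
  have "a \<noteq> 0" using assms by (metis tot_eq_0_iff nat.distinct(1) monom_mdeg_0)
  then obtain l m where l: "Poly_Mapping.lookup a (l, m) \<noteq> 0" by (auto simp: poly_mapping_eq_iff fun_eq_iff)
  define b where "b = a - Poly_Mapping.single (l, m) 1"
  have a: "a = Poly_Mapping.single (l, m) 1 + b"
    using l by (intro poly_mapping_eqI) (auto simp: b_def lookup_add lookup_minus lookup_single when_def)
  moreover from this have "tot (monom_mdeg b) = n" using assms by simp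
  ultimately show ?thesis by (rule that)
qed

text \<open>
  Along the curve \<open>(s : t) \<mapsto> (s u\<^sub>l + t v\<^sub>l)\<^sub>l\<close> a form of total degree \<open>n\<close> is a binary form of degree
  \<open>n\<close>; for \<open>n \<le> 2\<close> its value at \<open>(1 : -1)\<close> is determined by those at \<open>(1 : 0)\<close>, \<open>(0 : 1)\<close>, \<open>(1 : 1)\<close>.
\<close>

lemma monom_val_interpolation:
  assumes "n \<le> 2"
  shows "\<exists>\<alpha> \<beta> \<gamma>. \<forall>a. tot (monom_mdeg a) = n \<longrightarrow>
    monom_val (u - v) a = \<alpha> * monom_val u a + \<beta> * monom_val v a + \<gamma> * monom_val (u + v) a"
proof -
  consider "n = 0" | "n = Suc 0" | "n = Suc (Suc 0)" using assms by linarith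
  then show ?thesis
  proof cases
    case 1
    then show ?thesis by (intro exI[of _ 1] exI[of _ 0]) auto
  next
    case 2
    have "monom_val (u - v) a = 1 * monom_val u a + (-1) * monom_val v a + 0 * monom_val (u + v) a"
      if "tot (monom_mdeg a) = Suc 0" for a
      using that by (rule monomial_split) (simp add: monom_val_add)
    then show ?thesis using 2 by blast
  next
    case 3
    \<comment> \<open>The coefficients come from the polarised parallelogram law: (p - q)(p' - q') +
      (p + q)(p' + q') = 2pp' + 2qq'.\<close>
    have "monom_val (u - v) a = 2 * monom_val u a + 2 * monom_val v a + (-1) * monom_val (u + v) a"
      if a: "tot (monom_mdeg a) = Suc (Suc 0)" for a
    proof -
      obtain l m b where b: "a = Poly_Mapping.single (l, m) 1 + b" "tot (monom_mdeg b) = Suc 0"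
        using a by (rule monomial_split)
      obtain l' m' c where c: "b = Poly_Mapping.single (l', m') 1 + c" "tot (monom_mdeg c) = 0"
        using b(2) by (rule monomial_split)
      show ?thesis using b(1) c by (simp add: monom_val_add algebra_simps)
    qed
    then show ?thesis using 3 by blast
  qed
qed

lemma lin_ext_weights_add: "lin_ext (\<lambda>a. w a + w' a) F = lin_ext w F + lin_ext w' F"
  by (simp add: lin_ext_def sum.distrib algebra_simps)

text \<open>The interpolation coefficients depend only on the total degree, so one relation serves
  all monomials of degree \<open>e\<close> at once.\<close>

lemma comp_eval_interpolation:
  assumes "tot e \<le> 2" "comp_eval e u F = 0" "comp_eval e v F = 0" "comp_eval e (u + v) F = 0"
  shows "comp_eval e (u - v) F = 0"
proof -
  obtain \<alpha> \<beta> \<gamma> where *: "\<And>a. tot (monom_mdeg a) = tot e \<Longrightarrow>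
      monom_val (u - v) a = \<alpha> * monom_val u a + \<beta> * monom_val v a + \<gamma> * monom_val (u + v) a"
    using monom_val_interpolation[OF assms(1)] by blast
  let ?w = "\<lambda>x a. if monom_mdeg a = e then monom_val x a else 0"
  have "comp_eval e (u - v) F = lin_ext (\<lambda>a. \<alpha> * ?w u a + \<beta> * ?w v a + \<gamma> * ?w (u + v) a) F"
    unfolding comp_eval_def by (rule lin_ext_cong) (simp add: *)
  also have "\<dots> = \<alpha> * comp_eval e u F + \<beta> * comp_eval e v F + \<gamma> * comp_eval e (u + v) F"
    unfolding comp_eval_def lin_ext_weights_add lin_ext_cmult ..
  finally show ?thesis using assms by simp
qed

text \<open>A monomial of total degree at most 1 sees at most one factor, so at the mixed point it
  takes its value at \<open>u\<close> or at \<open>v\<close>. This point serves as test point for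
  the bilinear forms.\<close>

lemma comp_eval_mixed_point:
  assumes "tot e \<le> 1" "comp_eval e u F = 0" "comp_eval e v F = 0"
  shows "comp_eval e (\<lambda>l. if l = b then v l else u l) F = 0"
proof -
  let ?x = "\<lambda>l. if l = b then v l else u l"
  have "monom_val ?x a = monom_val (if e b = 0 then u else v) a" if a: "monom_mdeg a = e" for a
  proof (cases "tot e = 0")
    case True
    then show ?thesis using a by simp
  next
    case False
    then have "tot (monom_mdeg a) = Suc 0" unfolding a using assms(1) by linarith
    then obtain l m c where "a = Poly_Mapping.single (l, m) 1 + c" "tot (monom_mdeg c) = 0"
      by (rule monomial_split)
    then have "a = Poly_Mapping.single (l, m) 1" by simp
    then show ?thesis using a by (auto simp: unit_mdeg_def)
  qed
  then have "comp_eval e ?x F = comp_eval e (if e b = 0 then u else v) F"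
    unfolding comp_eval_def by (intro lin_ext_cong) auto
  then show ?thesis using assms by simp
qed

section \<open>Degrees that force a generator of the ideal\<close>

lemma det2_simps:
  "det2 u u = 0" "det2 (u + v) w = det2 u w + det2 v w" "det2 (u - v) w = det2 u w - det2 v w"
  "det2 w (u + v) = det2 w u + det2 w v" "det2 w (- u) = - det2 w u" "det2 (\<lambda>m. c * u m) w = c * det2 u w"
  by (simp_all add: det2_def algebra_simps)

lemma det2_swap: "det2 v u = - det2 u v"
  by (simp add: det2_def)

text \<open>A certificate that \<open>F\<close> is not generated from lower degrees: the point
  \<open>x\<close> separates \<open>F\<close> from all components of the ideal in degrees below
  \<open>d\<close>.\<close>

definition leading_at :: "(3 \<Rightarrow> (2 \<Rightarrow> 'k::field) set) set \<Rightarrow> mdeg \<Rightarrow> (3 \<Rightarrow> 2 \<Rightarrow> 'k) \<Rightarrow> 'k mpoly \<Rightarrow> bool" where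
  "leading_at X d x F \<longleftrightarrow> F \<in> vanishing_ideal X \<and> F \<in> graded_piece d \<and> eval_form x F \<noteq> 0 \<and>
     (\<forall>e<d. \<forall>G\<in>vanishing_ideal X. comp_eval e x G = 0)"

locale framed_points =
  fixes P Q R :: "3 \<Rightarrow> (2 \<Rightarrow> 'k::field_char_0) set" and u v :: "3 \<Rightarrow> 2 \<Rightarrow> 'k"
  assumes P1: "P l \<in> P1" "Q l \<in> P1" "R l \<in> P1"
    and frame: "u l \<in> P l" "v l \<in> Q l" "u l + v l \<in> R l" "det2 (u l) (v l) \<noteq> 0"
begin

lemma det2_P: "x \<in> P l \<Longrightarrow> det2 x (u l) = 0"
  and det2_Q: "x \<in> Q l \<Longrightarrow> det2 x (v l) = 0"
  and det2_R: "x \<in> R l \<Longrightarrow> det2 x (u l + v l) = 0"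
  using det2_same_class P1 frame by blast+

lemma comp_eval_frame:
  assumes "G \<in> vanishing_ideal {P, Q, R}"
  shows "comp_eval e u G = 0" "comp_eval e v G = 0" "comp_eval e (u + v) G = 0"
  using frame comp_eval_vanishing_ideal[OF assms, of P u] comp_eval_vanishing_ideal[OF assms, of Q v]
    comp_eval_vanishing_ideal[OF assms, of R "u + v"] by auto

lemma leading_total_3:
  assumes "tot d = 3"
  shows "\<exists>F. leading_at {P, Q, R} d (u - v) F"
proof -
  obtain a d' where a: "d = unit_mdeg a + d'" "tot d' = Suc (Suc 0)"
    using assms mdeg_split[of d 2] by (metis numeral_2_eq_2 numeral_3_eq_3)
  obtain b d'' where b: "d' = unit_mdeg b + d''" "tot d'' = Suc 0" using a(2) by (rule mdeg_split)
  obtain c d0 where c: "d'' = unit_mdeg c + d0" "tot d0 = 0" using b(2) by (rule mdeg_split)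
  \<comment> \<open>One linear factor for each of the three points; \<open>a\<close>,
    \<open>b\<close>, \<open>c\<close> may coincide.\<close>
  define F where "F = lin_form a (u a) * (lin_form b (v b) * lin_form c (u c + v c))"
  have deg: "F \<in> graded_piece d"
    unfolding F_def using a b c by (simp add: graded_piece_mult lin_form_graded)
  have ev: "eval_form x F = det2 (x a) (u a) * (det2 (x b) (v b) * det2 (x c) (u c + v c))" for x
    by (simp add: F_def eval_form_mult)
  have "F \<in> vanishing_ideal {P, Q, R}"
    using deg by (rule vanishing_idealI) (auto simp: vanishes_at_def ev det2_P det2_Q det2_R)
  \<comment> \<open>The factors are \<open>det2 (u a) (v a)\<close>, \<open>det2 (u b) (v b)\<close>
    and twice \<open>det2 (u c) (v c)\<close>, which is nonzero in characteristic 0.\<close>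
  moreover have "eval_form (u - v) F \<noteq> 0"
    using frame(4) by (simp add: ev det2_simps det2_swap[of "v _" "u _"])
  moreover have "comp_eval e (u - v) G = 0" if "e < d" "G \<in> vanishing_ideal {P, Q, R}" for e G
    using tot_strict_mono[OF that(1)] assms comp_eval_frame[OF that(2)]
    by (intro comp_eval_interpolation) auto
  ultimately show ?thesis using deg unfolding leading_at_def by blast
qed

text \<open>With coordinates (s : t) in factor \<open>a\<close> and (s' : t') in factor
  \<open>b\<close> relative to the frames, \<open>F\<close> is a nonzero multiple of s't - st', the
  equation of the graph identifying the two factors. It vanishes on the whole curve, so the test
  point \<open>x\<close> is taken off it, with (1 : 0) in factor \<open>a\<close> and (0 : 1) in
  factor \<open>b\<close>.\<close>

lemma leading_pair:
  assumes "a \<noteq> b"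
  shows "\<exists>x F. leading_at {P, Q, R} (unit_mdeg a + unit_mdeg b) x F"
proof -
  define x where "x = (\<lambda>l. if l = b then v l else u l)"
  define F where "F = lin_form a (v a) * lin_form b (u b) + lin_form a (u a) * lin_form b (- v b)"
  have deg: "F \<in> graded_piece (unit_mdeg a + unit_mdeg b)"
    unfolding F_def by (intro graded_piece_add graded_piece_mult lin_form_graded)
  have ev: "eval_form y F = det2 (y a) (v a) * det2 (y b) (u b) - det2 (y a) (u a) * det2 (y b) (v b)" for y
    by (simp add: F_def eval_form_mult eval_form_add det2_simps)
  have "F \<in> vanishing_ideal {P, Q, R}"
  proof (rule vanishing_idealI[OF deg])
    fix S assume "S \<in> {P, Q, R}"
    moreover have "vanishes_at F R"
      unfolding vanishes_at_def
    proof safe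
      fix y assume y: "\<forall>l. y l \<in> R l"
      \<comment> \<open>Representatives of \<open>R\<close> may be scaled independently in each
        factor; \<open>F\<close> is linear in each of the two, so the scalars factor out.\<close>
      have "\<exists>c. y l = (\<lambda>m. c * (u l + v l) m)" for l
        using P1_eq(1)[OF P1(3) frame(3), of l] y by blast
      then obtain c where "\<And>l. y l = (\<lambda>m. c l * (u l + v l) m)" by metis
      then have "det2 (y l) w = c l * det2 (u l + v l) w" for l w by (simp only: det2_simps(6))
      then show "eval_form y F = 0"
        by (simp add: ev det2_simps det2_swap[of "v _" "u _"])
    qed
    ultimately show "vanishes_at F S" by (auto simp: vanishes_at_def ev det2_P det2_Q)
  qed
  moreover have "eval_form x F \<noteq> 0"
    using frame(4) assms by (simp add: ev x_def det2_simps det2_swap[of "v _" "u _"])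
  moreover have "comp_eval e x G = 0"
    if "e < unit_mdeg a + unit_mdeg b" "G \<in> vanishing_ideal {P, Q, R}" for e G
    using tot_strict_mono[OF that(1)] comp_eval_frame[OF that(2)]
    unfolding x_def by (intro comp_eval_mixed_point) auto
  ultimately show ?thesis using deg unfolding leading_at_def by blast
qed

end

text \<open>Evaluating the component of degree \<open>d\<close> at its own test point gives the
  functionals for \<open>card_le_generators\<close>. Off the diagonal they vanish because each
  \<open>F d'\<close> is homogeneous of another degree.\<close>

lemma card_generators_ge_leading:
  assumes G: "finite G" "ideal_gen G = vanishing_ideal X"
    and J: "\<And>d. d \<in> J \<Longrightarrow> \<exists>x F. leading_at X d x F"
  shows "card J \<le> card G"
proof -
  obtain x F where L: "\<And>d. d \<in> J \<Longrightarrow> leading_at X d (x d) (F d)" using J by metis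
  show ?thesis
  proof (rule card_le_generators[OF G, where \<phi> = "\<lambda>d. comp_eval d (x d)" and f = F])
    fix d A B assume "d \<in> J" "B \<in> vanishing_ideal X"
    then show "comp_eval d (x d) (A * B) = Poly_Mapping.lookup A 0 * comp_eval d (x d) B"
      using L[of d] unfolding leading_at_def by (intro comp_eval_mult_leading) blast
  next
    fix d assume "d \<in> J"
    then show "F d \<in> vanishing_ideal X" "comp_eval d (x d) (F d) \<noteq> 0"
      using L[of d] unfolding leading_at_def by (auto simp: comp_eval_graded)
  next
    fix d d' assume "d' \<in> J" "d \<noteq> d'"
    then show "comp_eval d (x d) (F d') = 0"
      using L[of d'] comp_eval_graded[of "F d'" d' d "x d"] unfolding leading_at_def by auto
  qed (simp add: comp_eval_def lin_ext_add)
qed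


theorem theorem5p6:
  fixes X :: "(3 \<Rightarrow> (2 \<Rightarrow> 'k::{alg_closed_field, field_char_0}) set) set"
  assumes "X \<subseteq> P1xP1xP1"
    and "card X = 3"
    and "generic_position X"
  shows "num_gens (vanishing_ideal X) > enat (nat (v111 3))"
proof -
  obtain P Q R where X: "X = {P, Q, R}" and ne: "P \<noteq> Q" "P \<noteq> R" "Q \<noteq> R"
    using assms(2) unfolding card_3_iff by auto
  have P1: "P l \<in> P1" "Q l \<in> P1" "R l \<in> P1" for l
    using assms(1) X by (auto simp: P1xP1xP1_def)
  have "\<exists>u v. u \<in> P l \<and> v \<in> Q l \<and> u + v \<in> R l \<and> det2 u v \<noteq> 0" for l
    using generic_position_coordinates_distinct[OF assms] ne X P1 by (intro P1_frame) auto
  then obtain u v where "\<And>l. u l \<in> P l \<and> v l \<in> Q l \<and> u l + v l \<in> R l \<and> det2 (u l) (v l) \<noteq> 0"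
    by metis
  then interpret framed_points P Q R u v
    using P1 by unfold_locales auto
  \<comment> \<open>\<open>A\<close> holds the bilinear degrees and \<open>B\<close> all degrees of
    total degree 3; together they are 13 distinct degrees.\<close>
  define A where "A = {mk 1 1 0, mk 1 0 1, mk 0 1 1}"
  define B where "B = {mk 3 0 0, mk 0 3 0, mk 0 0 3, mk 2 1 0, mk 2 0 1, mk 1 2 0, mk 0 2 1,
    mk 1 0 2, mk 0 1 2, mk 1 1 1}"
  have "\<exists>x F. leading_at X d x F" if "d \<in> A" for d
  proof -
    have "d = unit_mdeg 1 + unit_mdeg 2 \<or> d = unit_mdeg 1 + unit_mdeg 3 \<or> d = unit_mdeg 2 + unit_mdeg 3"
      using that by (auto simp: A_def unit_mdeg_mk)
    then show ?thesis unfolding X by (elim disjE) (simp_all add: leading_pair)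
  qed
  moreover have "\<exists>x F. leading_at X d x F" if "d \<in> B" for d
  proof -
    have "tot (mk a b c) = a + b + c" for a b c
      unfolding tot_def sum_3 by (simp add: mk_def)
    then have "tot d = 3" using that by (auto simp: B_def)
    then show ?thesis unfolding X using leading_total_3 by blast
  qed
  moreover have "card (A \<union> B) = 13" by (simp add: A_def B_def)
  ultimately have "13 \<le> card G" if "finite G" "ideal_gen G = vanishing_ideal X" for G
    using card_generators_ge_leading[OF that, of "A \<union> B"] by auto
  then have "enat 13 \<le> num_gens (vanishing_ideal X)"
    unfolding num_gens_def by (intro INF_greatest) auto
  moreover have "enat (nat (v111 3)) < enat 13" by (simp add: v111_3)
  ultimately show ?thesis by (rule less_le_trans[rotated])
qed

end
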